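(* Let $(X_j,\rho_j)$, $j=1,2$, be ordinary compact metric spaces, with associated compact quantum metric spaces $(A_j,L_j)$. Then $$\operatorname{dist}_q(A_1,A_2)\le\operatorname{dist}_{GH}(X_1,X_2).$$
   Context: An order-unit space is a real partially ordered vector space $A$ with a distinguished element $e=e_A$ (the order unit) such that (1) for each $a\in A$ there is $r\in\mathbb{R}$ with $a\le re$; (2) if $a\in A$ and $a\le re$ for all real $r>0$, then $a\le 0$. Its norm is $\|a\|=\inf\{r: -re\le a\le re\}$. A state is an element $\mu$ of the Banach-space dual $A'$ with $\mu(e)=1=\|\mu\|'$; $S(A)$ denotes the set of states, with the $w^*$-topology. For a seminorm $L$ on $A$ put $\rho_L(\mu,\nu)=\sup\{|\mu(a)-\nu(a)|: L(a)\le 1\}$ for $\mu,\nu\in S(A)$. A Lip-norm on $A$ is a seminorm $L$ such that $L(a)=0$ iff $a\in\mathbb{R}e$, and the topology on $S(A)$ from $\rho_L$ is the $w^*$-topology. A compact quantum metric space is a pair $(A,L)$ with $A$ an order-unit space and $L$ a Lip-norm on $A$. For compact quantum metric spaces $(A,L_A)$, $(B,L_B)$, the direct sum $A\oplus B$ is an order-unit space with order unit $(e_A,e_B)$ and componentwise order; via the coordinate projections, $S(A)$ and $S(B)$ are viewed as subsets of $S(A\oplus B)$. $\mathcal{M}(L_A,L_B)$ is the set of Lip-norms $L$ on $A\oplus B$ which induce $L_A$ and $L_B$, i.e. $L_A(a)=\inf_{b\in B}L(a,b)$ and $L_B(b)=\inf_{a\in A}L(a,b)$. The quantum Gromov–Hausdorff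 distance is $\operatorname{dist}_q(A,B)=\inf\{\operatorname{dist}_H^{\rho_L}(S(A),S(B)): L\in\mathcal{M}(L_A,L_B)\}$, where $\operatorname{dist}_H^{\rho_L}$ is Hausdorff distance for $\rho_L$. The compact quantum metric space associated to an ordinary compact metric space $(X,\rho)$ is $(A,L)$, where $A$ is the order-unit space of real-valued Lipschitz functions on $X$ (pointwise order, unit the constant function $1$) and $L(f)=\sup\{|f(x)-f(y)|/\rho(x,y): x\ne y\}$. The ordinary Gromov–Hausdorff distance $\operatorname{dist}_{GH}(X_1,X_2)$ is the infimum of the Hausdorff distances $\operatorname{dist}_H^\rho(X_1,X_2)$ over all metrics $\rho$ on the disjoint union of $X_1$ and $X_2$ which give its disjoint-union topology and restrict to $\rho_1$ and $\rho_2$. *)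

theory Defs
  imports "HOL-Analysis.Analysis"
begin

text \<open>
  Order-unit spaces are carried by types of class \<open>ordered_real_vector\<close>; the order unit
  \<open>e\<close> is passed explicitly. The direct sum is the product type with its componentwise
  order (\<open>HOL-Library.Product_Order\<close>).
  All distances take values in \<open>ennreal\<close>: for a seminorm that is not (yet known to be) a
  Lip-norm, the supremum defining \<open>rho_L\<close> may be infinite.
\<close>

text \<open>
  \<open>HOL-Analysis\<close> declares these arities of \<open>prod\<close> for \<open>ordered_euclidean_space\<close> only; they
  are generalized superclass by superclass, as instance declarations must be coregular.
\<close>

instance prod :: (ordered_ab_group_add, ordered_ab_group_add) ordered_ab_semigroup_add
  by standard (auto simp: less_eq_prod_def)

instance prod :: (ordered_ab_group_add, ordered_ab_group_add) strict_ordered_ab_semigroup_add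
proof
  fix a b c d :: "'a \<times> 'b"
  assume ab: "a < b" and cd: "c < d"
  have "b \<le> a" if "b + d \<le> a + c"
  proof -
    have "b + d \<le> a + d"
      using that cd by (meson add_left_mono order.strict_implies_order order_trans)
    then show ?thesis by (simp add: less_eq_prod_def)
  qed
  moreover have "a + c \<le> b + d"
    using ab cd by (simp add: add_mono order.strict_implies_order)
  ultimately show "a + c < b + d"
    using ab by (auto simp: less_le_not_le)
qed

instance prod :: (ordered_ab_group_add, ordered_ab_group_add) ordered_cancel_ab_semigroup_add ..

instance prod :: (ordered_ab_group_add, ordered_ab_group_add) ordered_comm_monoid_add ..

instance prod :: (ordered_ab_group_add, ordered_ab_group_add) ordered_cancel_comm_monoid_add ..

instance prod :: (ordered_ab_group_add, ordered_ab_group_add) ordered_ab_semigroup_add_imp_le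
  by standard (auto simp: less_eq_prod_def)

instance prod :: (ordered_ab_group_add, ordered_ab_group_add) ordered_ab_group_add ..

instance prod :: (ordered_real_vector, ordered_real_vector) ordered_real_vector
  by standard (auto simp: less_eq_prod_def intro: scaleR_left_mono scaleR_right_mono)

section \<open>Order-unit spaces and their states\<close>

definition order_unit :: "'a::ordered_real_vector \<Rightarrow> bool" where
  "order_unit e \<longleftrightarrow>
     (\<forall>a. \<exists>r. a \<le> r *\<^sub>R e) \<and>
     (\<forall>a. (\<forall>r>0. a \<le> r *\<^sub>R e) \<longrightarrow> a \<le> 0)"

definition ou_norm :: "'a::ordered_real_vector \<Rightarrow> 'a \<Rightarrow> real" where
  "ou_norm e a = Inf {r. - (r *\<^sub>R e) \<le> a \<and> a \<le> r *\<^sub>R e}"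

definition ou_dual :: "'a::ordered_real_vector \<Rightarrow> ('a \<Rightarrow> real) set" where
  "ou_dual e = {\<mu>. linear \<mu> \<and> (\<exists>K. \<forall>a. \<bar>\<mu> a\<bar> \<le> K * ou_norm e a)}"

definition ou_dual_norm :: "'a::ordered_real_vector \<Rightarrow> ('a \<Rightarrow> real) \<Rightarrow> real" where
  "ou_dual_norm e \<mu> = Sup {\<bar>\<mu> a\<bar> |a. ou_norm e a \<le> 1}"

definition ou_states :: "'a::ordered_real_vector \<Rightarrow> ('a \<Rightarrow> real) set" where
  "ou_states e = {\<mu> \<in> ou_dual e. \<mu> e = 1 \<and> ou_dual_norm e \<mu> = 1}"

text \<open>
  The topology of the type \<open>'a \<Rightarrow> real\<close> is the product topology, i.e. pointwise
  convergence, so the subspace topology below is the weak-* topology.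
\<close>

definition weak_star_topology :: "'a::ordered_real_vector \<Rightarrow> ('a \<Rightarrow> real) topology" where
  "weak_star_topology e = top_of_set (ou_states e)"


section \<open>Lip-norms\<close>

definition is_seminorm :: "('a::real_vector \<Rightarrow> real) \<Rightarrow> bool" where
  "is_seminorm L \<longleftrightarrow>
     (\<forall>a. 0 \<le> L a) \<and>
     (\<forall>a b. L (a + b) \<le> L a + L b) \<and>
     (\<forall>c a. L (c *\<^sub>R a) = \<bar>c\<bar> * L a)"

definition rho :: "('a \<Rightarrow> real) \<Rightarrow> ('a \<Rightarrow> real) \<Rightarrow> ('a \<Rightarrow> real) \<Rightarrow> ennreal" where
  "rho L \<mu> \<nu> = (SUP a\<in>{a. L a \<le> 1}. ennreal \<bar>\<mu> a - \<nu> a\<bar>)"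

definition rho_topology ::
  "'a::ordered_real_vector \<Rightarrow> ('a \<Rightarrow> real) \<Rightarrow> ('a \<Rightarrow> real) topology" where
  "rho_topology e L = topology (\<lambda>U. U \<subseteq> ou_states e \<and>
     (\<forall>\<mu>\<in>U. \<exists>\<epsilon>>0. \<forall>\<nu>\<in>ou_states e. rho L \<mu> \<nu> < \<epsilon> \<longrightarrow> \<nu> \<in> U))"

lemma openin_rho_topology:
  "openin (rho_topology e L) U \<longleftrightarrow> U \<subseteq> ou_states e \<and>
     (\<forall>\<mu>\<in>U. \<exists>\<epsilon>>0. \<forall>\<nu>\<in>ou_states e. rho L \<mu> \<nu> < \<epsilon> \<longrightarrow> \<nu> \<in> U)"
proof -
  define N where "N U \<mu> \<longleftrightarrow> (\<exists>\<epsilon>>0. \<forall>\<nu>\<in>ou_states e. rho L \<mu> \<nu> < \<epsilon> \<longrightarrow> \<nu> \<in> U)" for U \<mu>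
  have mono: "N V \<mu>" if "N U \<mu>" "U \<subseteq> V" for U V \<mu>
    using that unfolding N_def by (meson subsetD)
  have inter: "N (S \<inter> T) \<mu>" if "N S \<mu>" "N T \<mu>" for S T \<mu>
  proof -
    obtain \<epsilon> where e: "\<epsilon> > 0" "\<And>\<nu>. \<nu> \<in> ou_states e \<Longrightarrow> rho L \<mu> \<nu> < \<epsilon> \<Longrightarrow> \<nu> \<in> S"
      using \<open>N S \<mu>\<close> unfolding N_def by auto
    obtain \<delta> where d: "\<delta> > 0" "\<And>\<nu>. \<nu> \<in> ou_states e \<Longrightarrow> rho L \<mu> \<nu> < \<delta> \<Longrightarrow> \<nu> \<in> T"
      using \<open>N T \<mu>\<close> unfolding N_def by auto
    show ?thesis
      unfolding N_def by (rule exI[of _ "min \<epsilon> \<delta>"]) (simp add: e d)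
  qed
  have "istopology (\<lambda>U. U \<subseteq> ou_states e \<and> (\<forall>\<mu>\<in>U. N U \<mu>))"
    unfolding istopology_def
  proof (intro conjI allI impI)
    fix S T assume S: "S \<subseteq> ou_states e \<and> (\<forall>\<mu>\<in>S. N S \<mu>)"
      and T: "T \<subseteq> ou_states e \<and> (\<forall>\<mu>\<in>T. N T \<mu>)"
    show "S \<inter> T \<subseteq> ou_states e" using S by blast
    show "\<forall>\<mu>\<in>S \<inter> T. N (S \<inter> T) \<mu>" using S T inter by simp
  next
    fix K assume K: "\<forall>S\<in>K. S \<subseteq> ou_states e \<and> (\<forall>\<mu>\<in>S. N S \<mu>)"
    show "\<Union>K \<subseteq> ou_states e" using K by blast
    show "\<forall>\<mu>\<in>\<Union>K. N (\<Union>K) \<mu>" using K by (meson UnionE Union_upper mono)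
  qed
  then show ?thesis
    by (simp add: rho_topology_def topology_inverse' flip: N_def)
qed

definition lip_norm :: "'a::ordered_real_vector \<Rightarrow> ('a \<Rightarrow> real) \<Rightarrow> bool" where
  "lip_norm e L \<longleftrightarrow>
     order_unit e \<and> is_seminorm L \<and>
     (\<forall>a. L a = 0 \<longleftrightarrow> a \<in> range (\<lambda>r. r *\<^sub>R e)) \<and>
     rho_topology e L = weak_star_topology e"


section \<open>Quantum Gromov--Hausdorff distance\<close>

definition hausdorff_dist :: "('p \<Rightarrow> 'p \<Rightarrow> ennreal) \<Rightarrow> 'p set \<Rightarrow> 'p set \<Rightarrow> ennreal" where
  "hausdorff_dist d S T =
     max (SUP x\<in>S. INF y\<in>T. d x y) (SUP y\<in>T. INF x\<in>S. d x y)"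

definition admissible_lip_norms ::
  "'a::ordered_real_vector \<Rightarrow> ('a \<Rightarrow> real) \<Rightarrow>
   'b::ordered_real_vector \<Rightarrow> ('b \<Rightarrow> real) \<Rightarrow> ('a \<times> 'b \<Rightarrow> real) set" where
  "admissible_lip_norms eA LA eB LB = {L. lip_norm (eA, eB) L \<and>
     (\<forall>a. LA a = (INF b. L (a, b))) \<and>
     (\<forall>b. LB b = (INF a. L (a, b)))}"

text \<open>
  The state spaces of the summands are embedded into that of the direct sum by composing
  with the coordinate projections.
\<close>

definition dist_q ::
  "'a::ordered_real_vector \<Rightarrow> ('a \<Rightarrow> real) \<Rightarrow>
   'b::ordered_real_vector \<Rightarrow> ('b \<Rightarrow> real) \<Rightarrow> ennreal" where
  "dist_q eA LA eB LB = (INF L\<in>admissible_lip_norms eA LA eB LB.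
     hausdorff_dist (rho L)
       ((\<lambda>\<mu>. \<mu> \<circ> fst) ` ou_states eA)
       ((\<lambda>\<nu>. \<nu> \<circ> snd) ` ou_states eB))"


section \<open>The space of Lipschitz functions on a metric space\<close>

typedef (overloaded) 'x lipfun =
  "{f :: 'x::metric_space \<Rightarrow> real. \<exists>C. C-lipschitz_on UNIV f}"
  morphisms apply_lipfun Abs_lipfun
  using lipschitz_on_constant by blast

setup_lifting type_definition_lipfun

instantiation lipfun :: (metric_space) ordered_real_vector
begin

lift_definition zero_lipfun :: "'a lipfun" is "\<lambda>_. 0"
  using lipschitz_on_constant by blast

lift_definition plus_lipfun :: "'a lipfun \<Rightarrow> 'a lipfun \<Rightarrow> 'a lipfun"
  is "\<lambda>f g x. f x + g x"
  using lipschitz_on_add by blast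

lift_definition uminus_lipfun :: "'a lipfun \<Rightarrow> 'a lipfun"
  is "\<lambda>f x. - f x"
  using lipschitz_on_minus by blast

lift_definition minus_lipfun :: "'a lipfun \<Rightarrow> 'a lipfun \<Rightarrow> 'a lipfun"
  is "\<lambda>f g x. f x - g x"
  using lipschitz_on_diff by blast

lift_definition scaleR_lipfun :: "real \<Rightarrow> 'a lipfun \<Rightarrow> 'a lipfun"
  is "\<lambda>c f x. c * f x"
  using lipschitz_on_cmult_real by blast

lift_definition less_eq_lipfun :: "'a lipfun \<Rightarrow> 'a lipfun \<Rightarrow> bool"
  is "\<lambda>f g. \<forall>x. f x \<le> g x" .

definition less_lipfun :: "'a lipfun \<Rightarrow> 'a lipfun \<Rightarrow> bool" where
  "less_lipfun f g \<longleftrightarrow> f \<le> g \<and> \<not> g \<le> f"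

instance
proof
  fix f g h :: "'a lipfun" and c d :: real
  show "f + g + h = f + (g + h)" by transfer (simp add: add.assoc)
  show "f + g = g + f" by transfer (simp add: add.commute)
  show "0 + f = f" by transfer simp
  show "- f + f = 0" by transfer simp
  show "f - g = f + - g" by transfer simp
  show "c *\<^sub>R (f + g) = c *\<^sub>R f + c *\<^sub>R g" by transfer (simp add: distrib_left)
  show "(c + d) *\<^sub>R f = c *\<^sub>R f + d *\<^sub>R f" by transfer (simp add: distrib_right)
  show "c *\<^sub>R d *\<^sub>R f = (c * d) *\<^sub>R f" by transfer (simp add: mult.assoc)
  show "1 *\<^sub>R f = f" by transfer simp
  show "f < g \<longleftrightarrow> f \<le> g \<and> \<not> g \<le> f" by (rule less_lipfun_def)
  show "f \<le> f" by transfer simp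
  show "f \<le> g \<Longrightarrow> g \<le> h \<Longrightarrow> f \<le> h" by transfer (blast intro: order_trans)
  show "f \<le> g \<Longrightarrow> g \<le> f \<Longrightarrow> f = g" by transfer (rule ext, blast intro: order_antisym)
  show "f \<le> g \<Longrightarrow> h + f \<le> h + g" by transfer simp
  show "f \<le> g \<Longrightarrow> 0 \<le> c \<Longrightarrow> c *\<^sub>R f \<le> c *\<^sub>R g"
    by transfer (simp add: mult_left_mono)
  show "c \<le> d \<Longrightarrow> 0 \<le> f \<Longrightarrow> c *\<^sub>R f \<le> d *\<^sub>R f"
    by transfer (simp add: mult_right_mono)
qed

end

instantiation lipfun :: (metric_space) one
begin

lift_definition one_lipfun :: "'a lipfun" is "\<lambda>_. 1"
  using lipschitz_on_constant by blast

instance ..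

end

text \<open>The inserted \<open>0\<close> only matters for a one-point space, where there is no pair \<open>x \<noteq> y\<close>.\<close>

definition lip_const :: "'x::metric_space lipfun \<Rightarrow> real" where
  "lip_const f =
     Sup (insert 0 {\<bar>apply_lipfun f x - apply_lipfun f y\<bar> / dist x y |x y. x \<noteq> y})"


section \<open>Gromov--Hausdorff distance\<close>

definition admissible_metrics ::
  "('x::metric_space + 'y::metric_space \<Rightarrow> 'x + 'y \<Rightarrow> real) set" where
  "admissible_metrics = {d. Metric_space UNIV d \<and>
     (\<forall>U. openin (Metric_space.mtopology UNIV d) U \<longleftrightarrow> open (Inl -` U) \<and> open (Inr -` U)) \<and>
     (\<forall>x x'. d (Inl x) (Inl x') = dist x x') \<and>
     (\<forall>y y'. d (Inr y) (Inr y') = dist y y')}"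

definition dist_GH :: "'x::metric_space itself \<Rightarrow> 'y::metric_space itself \<Rightarrow> ennreal" where
  "dist_GH _ _ =
     (INF d\<in>(admissible_metrics :: ('x + 'y \<Rightarrow> 'x + 'y \<Rightarrow> real) set).
        hausdorff_dist (\<lambda>p q. ennreal (d p q)) (range Inl) (range Inr))"

end

theory Submission
  imports Defs
begin

text \<open>
  A metric \<open>d\<close> on the disjoint union yields the seminorm \<open>L (f, g)\<close>, the Lipschitz constant for
  \<open>d\<close> of the function glued from \<open>f\<close> and \<open>g\<close>. McShane's extension shows that \<open>L\<close> induces the two
  given Lip-norms. A Lipschitz partition of unity \<open>\<phi>\<close> approximates, uniformly on the unit ball
  of \<open>L\<close>, each \<open>f\<close> by \<open>\<Sum> f(p) \<phi>\<^sub>p\<close>; this makes the unit ball totally bounded modulo constants, so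
  \<open>L\<close> is a Lip-norm. If every \<open>p\<close> in the first space is within \<open>h\<close> of a point \<open>y\<^sub>p\<close> of the second,
  a state \<open>\<mu>\<close> is within \<open>h + \<epsilon>\<close> of the state \<open>g \<mapsto> \<Sum> \<mu>(\<phi>\<^sub>p) g(y\<^sub>p)\<close>. Hence the state spaces are no
  further apart than the spaces themselves.
\<close>

section \<open>States of an order-unit space\<close>

text \<open>Chaining the two bounds gives \<open>- (r *\<^sub>R e) \<le> r *\<^sub>R e\<close>,
  which for negative \<open>r\<close> squeezes \<open>r *\<^sub>R e\<close> to 0. This keeps the set
  under the infimum in \<open>ou_norm\<close> bounded below.\<close>

lemma order_bound_nonneg:
  fixes e :: "'a::ordered_real_vector"
  assumes e: "0 \<le> e" "e \<noteq> 0" and "- (r *\<^sub>R e) \<le> a" "a \<le> r *\<^sub>R e"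
  shows "0 \<le> r"
proof (rule ccontr)
  assume "\<not> 0 \<le> r"
  then have "r *\<^sub>R e \<le> 0"
    using e by (simp add: scaleR_nonpos_nonneg)
  moreover have "- (r *\<^sub>R e) \<le> r *\<^sub>R e"
    using assms by (meson order_trans)
  ultimately have "r *\<^sub>R e = 0"
    by (meson neg_le_0_iff_le order_antisym order_trans)
  with \<open>\<not> 0 \<le> r\<close> e show False by simp
qed

lemma ou_norm_le:
  assumes e: "0 \<le> e" "e \<noteq> 0" and "- (r *\<^sub>R e) \<le> a" "a \<le> r *\<^sub>R e"
  shows "ou_norm e a \<le> r"
proof -
  have "bdd_below {r. - (r *\<^sub>R e) \<le> a \<and> a \<le> r *\<^sub>R e}"
    using order_bound_nonneg[OF e] by (auto simp: bdd_below_def)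
  then show ?thesis
    unfolding ou_norm_def using assms by (intro cInf_lower) auto
qed

text \<open>The two one-sided bounds are enlarged to a common one. This uses
  \<open>0 \<le> e\<close>, which \<open>order_unit\<close> alone does not give: in the reals, -1
  satisfies \<open>order_unit\<close>.\<close>

lemma order_unit_bounds:
  assumes "order_unit e" "0 \<le> e"
  obtains r where "0 \<le> r" "- (r *\<^sub>R e) \<le> a" "a \<le> r *\<^sub>R e"
proof -
  obtain s t where s: "a \<le> s *\<^sub>R e" and t: "- a \<le> t *\<^sub>R e"
    using assms(1) unfolding order_unit_def by meson
  define r where "r = max 0 (max s t)"
  have "s *\<^sub>R e \<le> r *\<^sub>R e" "t *\<^sub>R e \<le> r *\<^sub>R e"
    using assms(2) by (auto simp: r_def intro!: scaleR_right_mono)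
  with s t have "a \<le> r *\<^sub>R e" "- a \<le> r *\<^sub>R e" by auto
  then show thesis
    by (intro that[of r]) (auto simp: r_def minus_le_iff)
qed

lemma ou_norm_nonneg:
  assumes "order_unit e" and e: "0 \<le> e" "e \<noteq> 0"
  shows "0 \<le> ou_norm e a"
  unfolding ou_norm_def
  using order_unit_bounds[OF assms(1) e(1), of a] order_bound_nonneg[OF e]
  by (intro cInf_greatest) blast+

lemma abs_le_of_positive:
  fixes e :: "'a::ordered_real_vector"
  assumes "linear \<mu>" "\<And>a. 0 \<le> a \<Longrightarrow> 0 \<le> \<mu> a" "\<mu> e = 1"
    and "- (r *\<^sub>R e) \<le> a" "a \<le> r *\<^sub>R e"
  shows "\<bar>\<mu> a\<bar> \<le> (r::real)"
proof -
  have "0 \<le> r *\<^sub>R e - a" using assms(5) by simp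
  moreover have "0 \<le> r *\<^sub>R e + a"
    using add_left_mono[OF assms(4), of "r *\<^sub>R e"] by simp
  ultimately have "0 \<le> \<mu> (r *\<^sub>R e - a)" "0 \<le> \<mu> (r *\<^sub>R e + a)"
    using assms(2) by blast+
  then show ?thesis
    using assms(1,3) by (simp add: linear_diff linear_add linear_scale)
qed

text \<open>Norm 1 forces positivity because \<open>e - b\<close> has norm at most 1 whenever
  \<open>b\<close> lies between 0 and \<open>e\<close>. Conversely, a positive functional with value
  1 at \<open>e\<close> is bounded by \<open>ou_norm\<close>, and its dual norm is attained at
  \<open>e\<close>. Positivity is easy to check for the explicit states built later.\<close>

lemma ou_states_iff:
  assumes "order_unit e" and e: "0 \<le> e"
  shows "\<mu> \<in> ou_states e \<longleftrightarrow> linear \<mu> \<and> (\<forall>a. 0 \<le> a \<longrightarrow> 0 \<le> \<mu> a) \<and> \<mu> e = 1"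
proof (intro iffI conjI allI impI)
  assume \<mu>: "\<mu> \<in> ou_states e"
  then show lin: "linear \<mu>" and e1: "\<mu> e = 1"
    by (auto simp: ou_states_def ou_dual_def)
  have "e \<noteq> 0" using e1 lin by (auto simp: linear_0)
  obtain K where K: "\<And>a. \<bar>\<mu> a\<bar> \<le> K * ou_norm e a"
    using \<mu> by (auto simp: ou_states_def ou_dual_def)
  \<comment> \<open>The sign of \<open>K\<close> is unknown, hence the absolute value. The bound
    makes the real supremum in \<open>ou_dual_norm\<close> meaningful.\<close>
  have "\<bar>\<mu> a\<bar> \<le> \<bar>K\<bar>" if "ou_norm e a \<le> 1" for a
  proof -
    have "K * ou_norm e a \<le> \<bar>K\<bar> * 1"
      using that ou_norm_nonneg[OF assms \<open>e \<noteq> 0\<close>] by (intro mult_mono) auto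
    with K[of a] show ?thesis by simp
  qed
  then have bdd: "bdd_above {\<bar>\<mu> a\<bar> |a. ou_norm e a \<le> 1}"
    by (auto simp: bdd_above_def)
  have le1: "\<bar>\<mu> a\<bar> \<le> 1" if "ou_norm e a \<le> 1" for a
  proof -
    have "\<bar>\<mu> a\<bar> \<le> ou_dual_norm e \<mu>"
      unfolding ou_dual_norm_def using that by (intro cSup_upper bdd) auto
    with \<mu> show ?thesis by (simp add: ou_states_def)
  qed
  fix a :: 'a assume "0 \<le> a"
  obtain r where r: "0 \<le> r" "a \<le> r *\<^sub>R e"
    using order_unit_bounds[OF assms, of a] by blast
  \<comment> \<open>Raised by 1 to be strictly positive, since it becomes a divisor.\<close>
  define s where "s = r + 1"
  have s: "0 < s" "a \<le> s *\<^sub>R e"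
    using r e by (auto simp: s_def scaleR_left_distrib add_increasing2)
  have "(1/s) *\<^sub>R a \<le> (1/s) *\<^sub>R (s *\<^sub>R e)"
    using s by (intro scaleR_left_mono) auto
  moreover have "0 \<le> (1/s) *\<^sub>R a"
    using s \<open>0 \<le> a\<close> by (intro scaleR_nonneg_nonneg) auto
  \<comment> \<open>\<open>a / s\<close> lies between \<open>0\<close> and \<open>e\<close>, hence \<open>e - a / s\<close> lies in the unit ball.\<close>
  ultimately have "ou_norm e (e - (1/s) *\<^sub>R a) \<le> 1"
    using s e by (intro ou_norm_le e \<open>e \<noteq> 0\<close>) (auto intro: add_increasing2 simp: algebra_simps)
  from le1[OF this] have "\<mu> a / s \<ge> 0"
    using lin e1 by (simp add: linear_diff linear_scale)
  with s show "0 \<le> \<mu> a" by (simp add: zero_le_divide_iff)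
next
  assume A: "linear \<mu> \<and> (\<forall>a. 0 \<le> a \<longrightarrow> 0 \<le> \<mu> a) \<and> \<mu> e = 1"
  then have "e \<noteq> 0" by (auto simp: linear_0)
  have le: "\<bar>\<mu> a\<bar> \<le> ou_norm e a" for a
    unfolding ou_norm_def
  proof (rule cInf_greatest)
    show "{r. - (r *\<^sub>R e) \<le> a \<and> a \<le> r *\<^sub>R e} \<noteq> {}"
      using order_unit_bounds[OF assms, of a] by blast
  qed (use A abs_le_of_positive[of \<mu> e] in blast)
  have "- e \<le> e"
    using e by (meson neg_le_0_iff_le order_trans)
  then have "ou_norm e e \<le> 1"
    by (intro ou_norm_le e \<open>e \<noteq> 0\<close>) auto
  have "ou_dual_norm e \<mu> = 1"
    unfolding ou_dual_norm_def
  proof (rule cSup_eq_maximum)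
    show "1 \<in> {\<bar>\<mu> a\<bar> |a. ou_norm e a \<le> 1}"
      using A \<open>ou_norm e e \<le> 1\<close> by (auto intro!: exI[of _ e])
    show "x \<le> 1" if "x \<in> {\<bar>\<mu> a\<bar> |a. ou_norm e a \<le> 1}" for x
      using that le order_trans by blast
  qed
  then show "\<mu> \<in> ou_states e"
    using A le by (auto simp: ou_states_def ou_dual_def intro!: exI[of _ 1])
qed

lemma state_abs_le:
  assumes "order_unit e" "0 \<le> e" "\<mu> \<in> ou_states e" "- (r *\<^sub>R e) \<le> a" "a \<le> r *\<^sub>R e"
  shows "\<bar>\<mu> a\<bar> \<le> r"
  using assms abs_le_of_positive[of \<mu> e r a] by (simp add: ou_states_iff)

section \<open>A criterion for Lip-norms\<close>

lemma topspace_rho_topology [simp]: "topspace (rho_topology e L) = ou_states e"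
proof -
  have "openin (rho_topology e L) (ou_states e)"
    unfolding openin_rho_topology using zero_less_one by blast
  then show ?thesis
    by (metis openin_rho_topology openin_subset openin_topspace subset_antisym)
qed

lemma rho_le_iff:
  "0 \<le> r \<Longrightarrow> rho L \<mu> \<nu> \<le> ennreal r \<longleftrightarrow> (\<forall>a. L a \<le> 1 \<longrightarrow> \<bar>\<mu> a - \<nu> a\<bar> \<le> r)"
  by (simp add: rho_def SUP_le_iff)

text \<open>Dividing \<open>a\<close> by \<open>L a + 1\<close> moves it into the unit ball of
  \<open>L\<close>, where \<open>rho\<close> controls the difference of two states; the summand 1
  avoids a division by 0.\<close>

lemma continuous_map_eval_rho_topology:
  assumes L: "is_seminorm L"
  shows "continuous_map (rho_topology e L) euclideanreal (\<lambda>\<mu>. \<mu> a)"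
  unfolding continuous_map_def
proof (intro conjI allI impI)
  fix W :: "real set" assume "openin euclideanreal W"
  then have "open W" by simp
  have "\<exists>\<epsilon>>0. \<forall>\<nu>\<in>ou_states e. rho L \<mu> \<nu> < \<epsilon> \<longrightarrow> \<nu> a \<in> W"
    if \<mu>: "\<mu> \<in> ou_states e" "\<mu> a \<in> W" for \<mu>
  proof -
    obtain \<delta> where \<delta>: "\<delta> > 0" "ball (\<mu> a) \<delta> \<subseteq> W"
      using \<mu>(2) \<open>open W\<close> openE by blast
    define s where "s = L a + 1"
    have "0 \<le> L a" "L ((1/s) *\<^sub>R a) = \<bar>1/s\<bar> * L a"
      using L unfolding is_seminorm_def by blast+
    then have s: "s > 0" "L ((1/s) *\<^sub>R a) \<le> 1"
      by (simp_all add: s_def)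
    have "\<nu> a \<in> W" if \<nu>: "\<nu> \<in> ou_states e" "rho L \<mu> \<nu> < ennreal (\<delta>/s)" for \<nu>
    proof -
      have "linear \<mu>" "linear \<nu>" using \<mu> \<nu> by (auto simp: ou_states_def ou_dual_def)
      have "ennreal \<bar>\<mu> ((1/s) *\<^sub>R a) - \<nu> ((1/s) *\<^sub>R a)\<bar> \<le> rho L \<mu> \<nu>"
        unfolding rho_def using s by (intro SUP_upper) auto
      from this \<nu>(2) have "ennreal \<bar>\<mu> ((1/s) *\<^sub>R a) - \<nu> ((1/s) *\<^sub>R a)\<bar> < ennreal (\<delta>/s)"
        by (rule order_le_less_trans)
      then have "\<bar>\<mu> ((1/s) *\<^sub>R a) - \<nu> ((1/s) *\<^sub>R a)\<bar> < \<delta>/s"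
        by (simp add: ennreal_less_iff)
      moreover have "\<mu> ((1/s) *\<^sub>R a) - \<nu> ((1/s) *\<^sub>R a) = (\<mu> a - \<nu> a) / s"
        using \<open>linear \<mu>\<close> \<open>linear \<nu>\<close> by (simp add: linear_scale diff_divide_distrib)
      ultimately have "\<bar>\<mu> a - \<nu> a\<bar> < \<delta>"
        using s by (simp add: divide_less_cancel)
      with \<delta> show ?thesis by (auto simp: dist_real_def)
    qed
    moreover have "ennreal (\<delta>/s) > 0" using \<delta> s by simp
    ultimately show ?thesis by blast
  qed
  then show "openin (rho_topology e L) {\<mu> \<in> topspace (rho_topology e L). \<mu> a \<in> W}"
    unfolding openin_rho_topology by auto
qed auto

text \<open>
  The approximation hypothesis is a form of total boundedness, modulo constants, of the unit
  ball of \<open>L\<close> (Rieffel's criterion).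
\<close>

lemma lip_normI:
  fixes e :: "'a::ordered_real_vector"
  assumes e: "order_unit e" "0 \<le> e" and L: "is_seminorm L"
    and ker: "\<And>a. L a = 0 \<longleftrightarrow> a \<in> range (\<lambda>r. r *\<^sub>R e)"
    and tb: "\<And>\<epsilon>. \<epsilon> > 0 \<Longrightarrow> \<exists>(I::'i set) b C. finite I \<and> (\<forall>a. L a \<le> 1 \<longrightarrow> (\<exists>r c.
               (\<forall>i\<in>I. \<bar>c i\<bar> \<le> C) \<and>
               - (\<epsilon> *\<^sub>R e) \<le> a - r *\<^sub>R e - (\<Sum>i\<in>I. c i *\<^sub>R b i) \<and>
               a - r *\<^sub>R e - (\<Sum>i\<in>I. c i *\<^sub>R b i) \<le> \<epsilon> *\<^sub>R e))"
  shows "lip_norm e L"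
proof -
  have "openin (rho_topology e L) U" if "openin (weak_star_topology e) U" for U
  proof -
    obtain T where T: "open T" "U = ou_states e \<inter> T"
      using \<open>openin (weak_star_topology e) U\<close>
      unfolding weak_star_topology_def openin_open by blast
    \<comment> \<open>Convergence in the function type is coordinatewise, so continuity of all
      evaluations makes the identity continuous.\<close>
    have "continuous_map (rho_topology e L) euclidean (\<lambda>\<mu>. \<mu>)"
      using continuous_map_eval_rho_topology[OF L]
      by (simp add: continuous_map_componentwise_UNIV flip: euclidean_product_topology)
    then have "openin (rho_topology e L) {\<mu> \<in> topspace (rho_topology e L). \<mu> \<in> T}"
      using T(1) by (simp add: continuous_map_def)
    with T show ?thesis by (simp add: Int_def)
  qed
  moreover have "openin (weak_star_topology e) U" if U: "openin (rho_topology e L) U" for U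
    unfolding openin_subopen[of _ U]
  proof
    fix \<mu> assume "\<mu> \<in> U"
    then have \<mu>: "\<mu> \<in> ou_states e"
      using U by (auto simp: openin_rho_topology)
    then have "linear \<mu>" "\<mu> e = 1" using ou_states_iff[OF e] by auto
    obtain \<epsilon> where \<epsilon>: "\<epsilon> > 0" "\<And>\<nu>. \<nu> \<in> ou_states e \<Longrightarrow> rho L \<mu> \<nu> < \<epsilon> \<Longrightarrow> \<nu> \<in> U"
      using U \<open>\<mu> \<in> U\<close> unfolding openin_rho_topology by blast
    \<comment> \<open>The radius \<open>\<epsilon>\<close> is an \<open>ennreal\<close> and may be
      infinite; the estimates need a real one below it.\<close>
    obtain \<delta> :: real where \<delta>: "\<delta> > 0" "ennreal \<delta> < \<epsilon>"
    proof -
      obtain z where "0 < z" "z < \<epsilon>" using dense[OF \<epsilon>(1)] by blast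
      then show ?thesis using that by (cases z) (auto simp: ennreal_less_zero_iff)
    qed
    obtain I :: "'i set" and b C where I: "finite I" and C: "\<And>a. L a \<le> 1 \<Longrightarrow> \<exists>r c.
               (\<forall>i\<in>I. \<bar>c i\<bar> \<le> C) \<and>
               - ((\<delta>/4) *\<^sub>R e) \<le> a - r *\<^sub>R e - (\<Sum>i\<in>I. c i *\<^sub>R b i) \<and>
               a - r *\<^sub>R e - (\<Sum>i\<in>I. c i *\<^sub>R b i) \<le> (\<delta>/4) *\<^sub>R e"
      using tb[of "\<delta>/4"] \<delta> by auto
    \<comment> \<open>Budget: \<delta>/4 for approximating \<open>a\<close> under each of the two
      states, and \<delta>/2 for the sum over \<open>I\<close>. The summand 1 keeps the denominator
      positive when \<open>I\<close> is empty or \<open>C\<close> is 0.\<close>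
    define \<eta> where "\<eta> = \<delta> / (2 * (1 + card I * \<bar>C\<bar>))"
    have pos: "1 + card I * \<bar>C\<bar> > 0" by (smt (verit) mult_nonneg_nonneg of_nat_0_le_iff)
    then have "\<eta> > 0" using \<delta> by (simp add: \<eta>_def)
    have \<eta>: "card I * (\<bar>C\<bar> * \<eta>) \<le> \<delta>/2"
      using pos \<delta> by (simp add: \<eta>_def field_simps)
    define V where "V = (\<Inter>i\<in>I. {\<nu>. \<bar>\<nu> (b i) - \<mu> (b i)\<bar> < \<eta>})"
    have "open V"
      unfolding V_def using I
      by (intro open_INT ballI open_Collect_less continuous_intros continuous_on_product_coordinates)
    have "\<nu> \<in> U" if \<nu>: "\<nu> \<in> ou_states e" "\<nu> \<in> V" for \<nu>
    proof (rule \<epsilon>(2))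
      have "linear \<nu>" "\<nu> e = 1" using \<nu> ou_states_iff[OF e] by auto
      have "\<bar>\<mu> a - \<nu> a\<bar> \<le> \<delta>" if "L a \<le> 1" for a
      proof -
        obtain r c where c: "\<And>i. i \<in> I \<Longrightarrow> \<bar>c i\<bar> \<le> C"
          and a: "- ((\<delta>/4) *\<^sub>R e) \<le> a - r *\<^sub>R e - (\<Sum>i\<in>I. c i *\<^sub>R b i)"
            "a - r *\<^sub>R e - (\<Sum>i\<in>I. c i *\<^sub>R b i) \<le> (\<delta>/4) *\<^sub>R e"
          using C[OF \<open>L a \<le> 1\<close>] by blast
        have "\<bar>\<mu> (a - r *\<^sub>R e - (\<Sum>i\<in>I. c i *\<^sub>R b i))\<bar> \<le> \<delta>/4"
          "\<bar>\<nu> (a - r *\<^sub>R e - (\<Sum>i\<in>I. c i *\<^sub>R b i))\<bar> \<le> \<delta>/4"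
          using state_abs_le[OF e _ a] \<mu> \<nu> by auto
        \<comment> \<open>Both states are 1 at \<open>e\<close>, so the uncontrolled constant
          \<open>r\<close> enters both lines equally and cancels in the difference.\<close>
        then have 1: "\<bar>\<mu> a - r - (\<Sum>i\<in>I. c i * \<mu> (b i))\<bar> \<le> \<delta>/4"
          "\<bar>\<nu> a - r - (\<Sum>i\<in>I. c i * \<nu> (b i))\<bar> \<le> \<delta>/4"
          using \<open>linear \<mu>\<close> \<open>linear \<nu>\<close> \<open>\<mu> e = 1\<close> \<open>\<nu> e = 1\<close>
          by (simp_all add: linear_diff linear_sum linear_scale)
        have "\<bar>(\<Sum>i\<in>I. c i * \<mu> (b i)) - (\<Sum>i\<in>I. c i * \<nu> (b i))\<bar> \<le> (\<Sum>i\<in>I. \<bar>c i * (\<nu> (b i) - \<mu> (b i))\<bar>)"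
          by (subst abs_minus_commute) (simp add: right_diff_distrib sum_abs flip: sum_subtractf)
        also have "\<dots> \<le> card I * (\<bar>C\<bar> * \<eta>)"
        proof (rule sum_bounded_above)
          fix i assume "i \<in> I"
          then have "\<bar>c i\<bar> \<le> \<bar>C\<bar>" "\<bar>\<nu> (b i) - \<mu> (b i)\<bar> \<le> \<eta>"
            using c[of i] \<nu>(2) by (auto simp: V_def intro: less_imp_le)
          then show "\<bar>c i * (\<nu> (b i) - \<mu> (b i))\<bar> \<le> \<bar>C\<bar> * \<eta>"
            unfolding abs_mult by (intro mult_mono) auto
        qed
        finally show ?thesis using 1 \<eta> by linarith
      qed
      then have "rho L \<mu> \<nu> \<le> ennreal \<delta>"
        using \<delta> by (simp add: rho_le_iff)
      then show "rho L \<mu> \<nu> < \<epsilon>" using \<delta> by simp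
    qed (use \<nu> in auto)
    then have "ou_states e \<inter> V \<subseteq> U" by blast
    moreover have "openin (weak_star_topology e) (ou_states e \<inter> V)"
      using \<open>open V\<close> by (simp add: weak_star_topology_def openin_open_Int)
    moreover have "\<mu> \<in> V" using \<open>\<eta> > 0\<close> by (simp add: V_def)
    ultimately show "\<exists>T. openin (weak_star_topology e) T \<and> \<mu> \<in> T \<and> T \<subseteq> U"
      using \<mu> by blast
  qed
  ultimately have "rho_topology e L = weak_star_topology e"
    by (auto simp: topology_eq)
  then show ?thesis using e L ker by (auto simp: lip_norm_def)
qed

section \<open>Lipschitz functions on a compact metric space\<close>

lemmas apply_lipfun_simps [simp] =
  zero_lipfun.rep_eq plus_lipfun.rep_eq minus_lipfun.rep_eq uminus_lipfun.rep_eq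
  scaleR_lipfun.rep_eq one_lipfun.rep_eq

lemma apply_lipfun_sum [simp]: "apply_lipfun (sum F P) x = (\<Sum>p\<in>P. apply_lipfun (F p) x)"
  by (induction P rule: infinite_finite_induct) auto

lemma one_lipfun_nonneg [simp]: "0 \<le> (1 :: 'x::metric_space lipfun)"
  by transfer simp

lemma lipfun_bounded:
  fixes f :: "'x::metric_space lipfun"
  assumes "compact (UNIV :: 'x set)"
  obtains B where "\<And>x. \<bar>apply_lipfun f x\<bar> \<le> B"
proof -
  obtain C where "C-lipschitz_on UNIV (apply_lipfun f)"
    using apply_lipfun[of f] by blast
  then have "compact (range (apply_lipfun f))"
    by (intro compact_continuous_image assms lipschitz_on_continuous_on)
  then obtain B where "\<forall>y\<in>range (apply_lipfun f). norm y \<le> B"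
    by (meson bounded_iff compact_imp_bounded)
  then show thesis by (intro that[of B]) auto
qed

lemma order_unit_lipfun:
  assumes "compact (UNIV :: 'x::metric_space set)"
  shows "order_unit (1 :: 'x lipfun)"
  unfolding order_unit_def
proof (intro conjI allI impI)
  fix f :: "'x lipfun"
  obtain B where "\<And>x. \<bar>apply_lipfun f x\<bar> \<le> B"
    using lipfun_bounded[OF assms] by blast
  then show "\<exists>r. f \<le> r *\<^sub>R 1"
    by (auto simp: less_eq_lipfun.rep_eq abs_le_iff)
next
  fix f :: "'x lipfun" assume "\<forall>r>0. f \<le> r *\<^sub>R 1"
  then show "f \<le> 0"
    by (auto simp: less_eq_lipfun.rep_eq intro: field_le_epsilon)
qed

section \<open>Lipschitz partitions of unity and transport of states\<close>

lemma lipschitz_on_pos_part: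
  fixes f :: "'x::metric_space \<Rightarrow> real"
  assumes "C-lipschitz_on S f"
  shows "C-lipschitz_on S (\<lambda>x. max 0 (f x))"
proof (rule lipschitz_onI)
  fix x y assume "x \<in> S" "y \<in> S"
  then have "dist (f x) (f y) \<le> C * dist x y"
    using assms by (rule lipschitz_onD[rotated])
  then show "dist (max 0 (f x)) (max 0 (f y)) \<le> C * dist x y"
    by (auto simp: dist_real_def max_def)
qed (use assms in \<open>rule lipschitz_on_nonneg\<close>)

text \<open>
  Each new bump function is truncated at what the earlier ones leave of the constant \<open>1\<close>;
  only positive parts of Lipschitz functions occur, so no quotients are needed.
\<close>

lemma lipschitz_subpartition:
  fixes P :: "'x::metric_space set"
  assumes "finite P" "0 < \<epsilon>"
  shows "\<exists>\<phi> :: 'x \<Rightarrow> 'x lipfun. (\<forall>p. 0 \<le> \<phi> p)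
    \<and> (\<forall>p x. apply_lipfun (\<phi> p) x \<noteq> 0 \<longrightarrow> dist x p < 2 * \<epsilon>)
    \<and> (\<Sum>p\<in>P. \<phi> p) \<le> 1
    \<and> (\<forall>x. (\<exists>p\<in>P. dist x p < \<epsilon>) \<longrightarrow> apply_lipfun (\<Sum>p\<in>P. \<phi> p) x = 1)"
  using \<open>finite P\<close>
proof (induction P)
  case empty
  show ?case by (intro exI[of _ "\<lambda>_. 0"]) auto
next
  case (insert q P)
  from insert.IH obtain \<phi> :: "'x \<Rightarrow> 'x lipfun" where \<phi>: "\<forall>p. 0 \<le> \<phi> p"
    "\<forall>p x. apply_lipfun (\<phi> p) x \<noteq> 0 \<longrightarrow> dist x p < 2 * \<epsilon>"
    "(\<Sum>p\<in>P. \<phi> p) \<le> 1"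
    "\<forall>x. (\<exists>p\<in>P. dist x p < \<epsilon>) \<longrightarrow> apply_lipfun (\<Sum>p\<in>P. \<phi> p) x = 1"
    by (elim exE conjE) (rule that)
  define S where "S = apply_lipfun (\<Sum>p\<in>P. \<phi> p)"
  have "0 \<le> (\<Sum>p\<in>P. \<phi> p)"
    using \<phi>(1) by (simp add: sum_nonneg)
  then have S: "0 \<le> S x" "S x \<le> 1" for x
    using \<phi>(3) unfolding less_eq_lipfun.rep_eq S_def by (simp_all del: apply_lipfun_sum)
  obtain K where K: "K-lipschitz_on UNIV S"
    using apply_lipfun[of "\<Sum>p\<in>P. \<phi> p"] by (auto simp: S_def simp del: apply_lipfun_sum)
  \<comment> \<open>The inner positive part is 0 within \<epsilon> of \<open>q\<close> and at least
    1 beyond 2\<epsilon>. So \<open>g\<close> is the whole remainder \<open>1 - S x\<close> near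
    \<open>q\<close> and vanishes far away.\<close>
  define g where "g x = max 0 (1 - S x - max 0 ((1/\<epsilon>) * dist x q - 1))" for x
  have "1-lipschitz_on UNIV (\<lambda>x. dist x q)"
    by (rule lipschitz_onI) (simp_all add: dist_real_def, metis abs_dist_diff_le dist_commute)
  then have "(0 + K + (\<bar>1/\<epsilon>\<bar> * 1 + 0))-lipschitz_on UNIV g"
    unfolding g_def
    by (intro lipschitz_on_pos_part lipschitz_on_diff lipschitz_on_cmult_real
        lipschitz_on_constant K)
  then obtain \<psi> where \<psi>_def: "apply_lipfun \<psi> = g"
    using Abs_lipfun_inverse by blast
  have far: "dist x q < 2 * \<epsilon>" if "g x \<noteq> 0" for x
  proof -
    have "(1/\<epsilon>) * dist x q - 1 < 1"
      using that S[of x] by (auto simp: g_def max_def split: if_splits)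
    then show ?thesis using assms by (simp add: field_simps)
  qed
  have near: "g x = 1 - S x" if "dist x q < \<epsilon>" for x
  proof -
    have "(1/\<epsilon>) * dist x q - 1 \<le> 0" using that assms by (simp add: field_simps)
    then show ?thesis using S[of x] by (auto simp: g_def max_def)
  qed
  have g: "0 \<le> g x" "g x \<le> 1 - S x" for x
    using S[of x] by (auto simp: g_def)
  have "(\<Sum>p\<in>insert q P. (\<phi>(q := \<psi>)) p) = \<psi> + (\<Sum>p\<in>P. (\<phi>(q := \<psi>)) p)"
    using insert.hyps by simp
  also have "(\<Sum>p\<in>P. (\<phi>(q := \<psi>)) p) = (\<Sum>p\<in>P. \<phi> p)"
    using insert.hyps by (intro sum.cong) auto
  finally have sum: "apply_lipfun (\<Sum>p\<in>insert q P. (\<phi>(q := \<psi>)) p) x = g x + S x" for x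
    by (simp add: S_def \<psi>_def del: apply_lipfun_sum)
  have eq1: "g x + S x = 1" if "\<exists>p\<in>insert q P. dist x p < \<epsilon>" for x
  proof (cases "dist x q < \<epsilon>")
    case False
    \<comment> \<open>A point near an earlier centre has nothing left over, so \<open>g x\<close> is
      squeezed to 0.\<close>
    then have "S x = 1" using that \<phi>(4) unfolding S_def by blast
    then show ?thesis using g[of x] by simp
  qed (simp add: near)
  show ?case
  proof (intro exI[of _ "\<phi>(q := \<psi>)"] conjI allI impI)
    show "0 \<le> (\<phi>(q := \<psi>)) p" for p
      using \<phi>(1) g by (auto simp: less_eq_lipfun.rep_eq \<psi>_def)
    show "dist x p < 2 * \<epsilon>" if "apply_lipfun ((\<phi>(q := \<psi>)) p) x \<noteq> 0" for p x
      using that \<phi>(2) far by (auto simp: \<psi>_def split: if_splits)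
    show "(\<Sum>p\<in>insert q P. (\<phi>(q := \<psi>)) p) \<le> 1"
      unfolding less_eq_lipfun.rep_eq sum using g by (simp add: le_diff_eq)
    show "apply_lipfun (\<Sum>p\<in>insert q P. (\<phi>(q := \<psi>)) p) x = 1"
      if "\<exists>p\<in>insert q P. dist x p < \<epsilon>" for x
      unfolding sum using eq1 that by blast
  qed
qed

definition lip_partition :: "'x::metric_space set \<Rightarrow> ('x \<Rightarrow> 'x lipfun) \<Rightarrow> real \<Rightarrow> bool" where
  "lip_partition P \<phi> \<epsilon> \<longleftrightarrow> finite P \<and> (\<Sum>p\<in>P. \<phi> p) = 1 \<and> (\<forall>p. 0 \<le> \<phi> p) \<and>
     (\<forall>p x. apply_lipfun (\<phi> p) x \<noteq> 0 \<longrightarrow> dist x p < \<epsilon>)"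

lemma lip_partition_exists:
  assumes "compact (UNIV :: 'x::metric_space set)" "0 < \<epsilon>"
  obtains P and \<phi> :: "'x::metric_space \<Rightarrow> 'x lipfun" where "lip_partition P \<phi> \<epsilon>"
proof -
  \<comment> \<open>Half the radius, since the bumps may reach twice as far as the balls on which
    they sum to 1.\<close>
  obtain P :: "'x set" where P: "finite P" "UNIV \<subseteq> (\<Union>p\<in>P. ball p (\<epsilon>/2))"
    using compactE_image[OF assms(1), of UNIV "\<lambda>p. ball p (\<epsilon>/2)"] assms(2)
    by (metis (no_types, lifting) UNIV_I UN_I centre_in_ball half_gt_zero open_ball subsetI)
  obtain \<phi> :: "'x \<Rightarrow> 'x lipfun" where \<phi>: "\<forall>p. 0 \<le> \<phi> p"
    "\<forall>p x. apply_lipfun (\<phi> p) x \<noteq> 0 \<longrightarrow> dist x p < 2 * (\<epsilon>/2)"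
    "\<forall>x. (\<exists>p\<in>P. dist x p < \<epsilon>/2) \<longrightarrow> apply_lipfun (\<Sum>p\<in>P. \<phi> p) x = 1"
    using lipschitz_subpartition[OF P(1) half_gt_zero[OF assms(2)]] by (elim exE conjE) (rule that)
  have "\<exists>p\<in>P. dist x p < \<epsilon>/2" for x
    using P(2) by (force simp: dist_commute)
  then have "(\<Sum>p\<in>P. \<phi> p) = 1"
    using \<phi>(3) by (simp add: fun_eq_iff del: apply_lipfun_sum flip: apply_lipfun_inject)
  then have "lip_partition P \<phi> \<epsilon>"
    using P(1) \<phi>(1,2) by (simp add: lip_partition_def)
  then show thesis by (rule that)
qed

text \<open>As the bumps sum to 1, the error at \<open>x\<close> is the average of
  \<open>f x - c p\<close> with weights \<open>\<phi> p\<close> at \<open>x\<close>, and only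
  \<open>p\<close> within \<epsilon> of \<open>x\<close> have weight. The numbers \<open>c p\<close>
  need not be values of \<open>f\<close>; in \<open>state_transport\<close> they come from a
  function on the other space.\<close>

lemma lip_partition_approx:
  fixes f :: "'x::metric_space lipfun"
  assumes \<phi>: "lip_partition P \<phi> \<epsilon>"
    and near: "\<And>p x. dist x p < \<epsilon> \<Longrightarrow> \<bar>apply_lipfun f x - c p\<bar> \<le> r"
  shows "- (r *\<^sub>R 1) \<le> f - (\<Sum>p\<in>P. c p *\<^sub>R \<phi> p) \<and> f - (\<Sum>p\<in>P. c p *\<^sub>R \<phi> p) \<le> r *\<^sub>R 1"
proof -
  have "\<bar>apply_lipfun f x - (\<Sum>p\<in>P. c p * apply_lipfun (\<phi> p) x)\<bar> \<le> r" for x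
  proof -
    have 1: "(\<Sum>p\<in>P. apply_lipfun (\<phi> p) x) = 1"
      using \<phi> unfolding lip_partition_def by (metis apply_lipfun_sum one_lipfun.rep_eq)
    have "apply_lipfun f x - (\<Sum>p\<in>P. c p * apply_lipfun (\<phi> p) x)
        = (\<Sum>p\<in>P. (apply_lipfun f x - c p) * apply_lipfun (\<phi> p) x)"
      by (simp add: left_diff_distrib sum_subtractf 1 flip: sum_distrib_left)
    also have "\<bar>\<dots>\<bar> \<le> (\<Sum>p\<in>P. r * apply_lipfun (\<phi> p) x)"
    proof (rule sum_abs[THEN order_trans], rule sum_mono)
      fix p assume "p \<in> P"
      have "0 \<le> apply_lipfun (\<phi> p) x"
        using \<phi> by (auto simp: lip_partition_def less_eq_lipfun.rep_eq)
      moreover have "apply_lipfun (\<phi> p) x = 0 \<or> \<bar>apply_lipfun f x - c p\<bar> \<le> r"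
        using \<phi> near unfolding lip_partition_def by blast
      ultimately show "\<bar>(apply_lipfun f x - c p) * apply_lipfun (\<phi> p) x\<bar> \<le> r * apply_lipfun (\<phi> p) x"
        by (auto simp: abs_mult intro: mult_right_mono)
    qed
    also have "\<dots> = r" by (simp add: 1 flip: sum_distrib_left)
    finally show ?thesis .
  qed
  then show ?thesis
    by (auto simp: less_eq_lipfun.rep_eq abs_le_iff algebra_simps)
qed

text \<open>A choice of near points \<open>y\<close> need not be continuous, so \<mu> cannot simply
  be composed with it. Instead \<mu> is discretised to point masses of weight
  \<open>\<mu> (\<phi> p)\<close> at \<open>p\<close>, at a cost of \<epsilon>, and each mass is
  moved to \<open>y p\<close>, at a cost of \<open>h\<close>. The cost \<open>c\<close> stands for
  the cross distances, read in either direction.\<close>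

lemma state_transport:
  fixes c :: "'x::metric_space \<Rightarrow> 'y::metric_space \<Rightarrow> real"
  assumes X: "compact (UNIV :: 'x set)" and Y: "compact (UNIV :: 'y set)"
    and c: "\<And>x x' y. c x y \<le> dist x x' + c x' y" and near: "\<And>x. \<exists>y. c x y \<le> h"
    and \<mu>: "\<mu> \<in> ou_states (1 :: 'x lipfun)" and "0 < \<epsilon>"
  shows "\<exists>\<nu>\<in>ou_states (1 :: 'y lipfun). \<forall>f g.
    (\<forall>x y. \<bar>apply_lipfun f x - apply_lipfun g y\<bar> \<le> c x y) \<longrightarrow> \<bar>\<mu> f - \<nu> g\<bar> \<le> h + \<epsilon>"
proof -
  note ouX = order_unit_lipfun[OF X] and ouY = order_unit_lipfun[OF Y]
  obtain P \<phi> where \<phi>: "lip_partition P (\<phi> :: 'x \<Rightarrow> 'x lipfun) \<epsilon>"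
    using lip_partition_exists[OF X \<open>0 < \<epsilon>\<close>] .
  obtain y where y: "\<And>x. c x (y x) \<le> h" using near by metis
  have \<mu>': "linear \<mu>" "\<And>f. 0 \<le> f \<Longrightarrow> 0 \<le> \<mu> f" "\<mu> 1 = 1"
    using \<mu> ou_states_iff[OF ouX] by auto
  define \<nu> where "\<nu> g = (\<Sum>p\<in>P. apply_lipfun g (y p) * \<mu> (\<phi> p))" for g
  have "\<nu> 1 = \<mu> (\<Sum>p\<in>P. \<phi> p)"
    using \<mu>'(1) by (simp add: \<nu>_def linear_sum)
  then have "\<nu> 1 = 1"
    using \<phi> \<mu>'(3) by (simp add: lip_partition_def)
  moreover have "linear \<nu>"
    by (rule linearI) (simp_all add: \<nu>_def distrib_right sum.distrib sum_distrib_left mult.assoc)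
  moreover have "0 \<le> \<nu> g" if "0 \<le> g" for g
    using that \<phi> \<mu>'(2)
    by (auto simp: \<nu>_def less_eq_lipfun.rep_eq lip_partition_def intro!: sum_nonneg mult_nonneg_nonneg)
  ultimately have "\<nu> \<in> ou_states 1"
    by (simp add: ou_states_iff[OF ouY])
  moreover have "\<bar>\<mu> f - \<nu> g\<bar> \<le> h + \<epsilon>"
    if fg: "\<And>x y. \<bar>apply_lipfun f x - apply_lipfun g y\<bar> \<le> c x y" for f g
  proof -
    have "\<bar>apply_lipfun f x - apply_lipfun g (y p)\<bar> \<le> h + \<epsilon>" if "dist x p < \<epsilon>" for x p
      using that fg[of x "y p"] c[of x "y p" p] y[of p] by linarith
    then have "\<bar>\<mu> (f - (\<Sum>p\<in>P. apply_lipfun g (y p) *\<^sub>R \<phi> p))\<bar> \<le> h + \<epsilon>"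
      using state_abs_le[OF ouX _ \<mu>] lip_partition_approx[OF \<phi>] by simp
    then show ?thesis
      using \<mu>'(1) by (simp add: \<nu>_def linear_diff linear_sum linear_scale)
  qed
  ultimately show ?thesis by blast
qed

section \<open>The Lipschitz seminorm of a metric on the disjoint union\<close>

text \<open>The supremum of \<open>lip_const\<close> with the metric as a parameter, since the
  metric on the disjoint union varies and cannot be the \<open>dist\<close> of a type class.\<close>

definition lip_seminorm :: "('p \<Rightarrow> 'p \<Rightarrow> real) \<Rightarrow> ('p \<Rightarrow> real) \<Rightarrow> real" where
  "lip_seminorm d h = Sup (insert 0 {\<bar>h p - h q\<bar> / d p q |p q. p \<noteq> q})"

lemma lip_const_eq_lip_seminorm: "lip_const f = lip_seminorm dist (apply_lipfun f)"
  by (simp add: lip_const_def lip_seminorm_def)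

section \<open>Lipschitz constants and extensions in a metric space\<close>

context Metric_space
begin

text \<open>Some Lipschitz constant \<open>K\<close> must be known beforehand: it bounds the set of
  quotients, so that the real \<open>Sup\<close> is a least upper bound.\<close>

lemma lip_seminorm_le_iff:
  assumes M: "M = UNIV" and K: "\<And>p q. \<bar>h p - h q\<bar> \<le> K * d p q"
  shows "lip_seminorm d h \<le> C \<longleftrightarrow> 0 \<le> C \<and> (\<forall>p q. \<bar>h p - h q\<bar> \<le> C * d p q)"
proof -
  have pos: "0 < d p q" if "p \<noteq> q" for p q
    using that M by (simp add: mdist_pos_less)
  have "bdd_above (insert 0 {\<bar>h p - h q\<bar> / d p q |p q. p \<noteq> q})"
    using K pos by (intro bdd_aboveI[of _ "max 0 K"]) (auto simp: divide_le_eq le_max_iff_disj)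
  then have "lip_seminorm d h \<le> C \<longleftrightarrow> (\<forall>z\<in>insert 0 {\<bar>h p - h q\<bar> / d p q |p q. p \<noteq> q}. z \<le> C)"
    unfolding lip_seminorm_def by (intro cSup_le_iff) auto
  also have "\<dots> \<longleftrightarrow> 0 \<le> C \<and> (\<forall>p q. p \<noteq> q \<longrightarrow> \<bar>h p - h q\<bar> \<le> C * d p q)"
    using pos by (auto simp: divide_le_eq) (metis divide_le_eq)+
  also have "\<dots> \<longleftrightarrow> 0 \<le> C \<and> (\<forall>p q. \<bar>h p - h q\<bar> \<le> C * d p q)"
    using nonneg by (metis abs_zero cancel_comm_monoid_add_class.diff_cancel mult_nonneg_nonneg)
  finally show ?thesis .
qed

text \<open>McShane's formula: \<open>h\<close> is the infimum of the cones of slope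
  \<open>C\<close> standing on the graph of \<open>f\<close>. Each cone obeys the Lipschitz bound,
  hence so does the infimum.\<close>

lemma lipschitz_extension:
  assumes M: "M = UNIV" and "0 \<le> C" and C: "\<And>x x'. \<bar>f x - f x'\<bar> \<le> C * d (i x) (i x')"
  shows "\<exists>h. (\<forall>x. h (i x) = f x) \<and> (\<forall>p q. \<bar>h p - h q\<bar> \<le> C * d p q)"
proof -
  define h where "h p = (INF x. f x + C * d (i x) p)" for p
  have tri: "C * d p r \<le> C * d p q + C * d q r" for p q r
    using triangle[of p q r] M \<open>0 \<le> C\<close> by (simp add: mult_left_mono flip: distrib_left)
  \<comment> \<open>Any fixed \<open>x0\<close> bounds all cones at \<open>p\<close> from below, so
    the infimum is a genuine one.\<close>
  have "f x0 - C * d p (i x0) \<le> f x + C * d (i x) p" for p x x0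
    using C[of x0 x] tri[of "i x0" "i x" p] tri[of "i x" "i x0" p] tri[of "i x" p "i x0"]
    by (smt (verit) commute)
  then have bdd: "bdd_below (range (\<lambda>x. f x + C * d (i x) p))" for p
    by (intro bdd_belowI) blast
  have le: "h p \<le> f x + C * d (i x) p" for p x
    unfolding h_def by (intro cINF_lower bdd UNIV_I)
  have "h p - h q \<le> C * d p q" for p q
  proof -
    have "h p - C * d p q \<le> h q"
      unfolding h_def[of q]
    proof (rule cINF_greatest)
      fix x
      show "h p - C * d p q \<le> f x + C * d (i x) q"
        using le[of p x] tri[of "i x" p q] commute[of q p] by simp
    qed simp
    then show ?thesis by simp
  qed
  then have "\<bar>h p - h q\<bar> \<le> C * d p q" for p q
    by (smt (verit) commute)
  moreover have "h (i x) = f x" for x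
  proof (rule antisym)
    show "h (i x) \<le> f x" using le[of "i x" x] M by simp
    show "f x \<le> h (i x)"
      unfolding h_def using C[of x] by (intro cINF_greatest) (auto simp: commute abs_le_iff algebra_simps)
  qed
  ultimately show ?thesis by blast
qed

end

lemma lipfun_lipschitz:
  obtains K where "\<And>x y. \<bar>apply_lipfun f x - apply_lipfun f y\<bar> \<le> K * dist x y"
  using apply_lipfun[of f] by (auto simp: lipschitz_on_def dist_real_def)

lemma lip_const_le_iff:
  "lip_const f \<le> C \<longleftrightarrow>
     0 \<le> C \<and> (\<forall>x y. \<bar>apply_lipfun f x - apply_lipfun f y\<bar> \<le> C * dist x y)"
proof -
  obtain K where "\<And>x y. \<bar>apply_lipfun f x - apply_lipfun f y\<bar> \<le> K * dist x y"
    using lipfun_lipschitz by blast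
  then show ?thesis
    unfolding lip_const_eq_lip_seminorm by (intro Met_TC.lip_seminorm_le_iff) auto
qed

text \<open>Because \<open>k\<close> is isometric, the McShane extension read along \<open>k\<close>
  is again an element of \<open>lipfun\<close>. The maps \<open>i\<close> and \<open>k\<close> will
  be \<open>Inl\<close> and \<open>Inr\<close>, in either order.\<close>

lemma (in Metric_space) lipfun_extension:
  fixes f :: "'x::metric_space lipfun" and i :: "'x \<Rightarrow> 'a" and k :: "'y::metric_space \<Rightarrow> 'a"
  assumes M: "M = UNIV" and i: "\<And>x x'. d (i x) (i x') = dist x x'"
    and k: "\<And>y y'. d (k y) (k y') = dist y y'"
  shows "\<exists>(g :: 'y lipfun) h. (\<forall>x. h (i x) = apply_lipfun f x) \<and>
    (\<forall>y. h (k y) = apply_lipfun g y) \<and> (\<forall>p q. \<bar>h p - h q\<bar> \<le> lip_const f * d p q)"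
proof -
  have C: "0 \<le> lip_const f"
    "\<And>x x'. \<bar>apply_lipfun f x - apply_lipfun f x'\<bar> \<le> lip_const f * d (i x) (i x')"
    using lip_const_le_iff[of f "lip_const f"] i by auto
  obtain h where h: "\<forall>x. h (i x) = apply_lipfun f x" "\<forall>p q. \<bar>h p - h q\<bar> \<le> lip_const f * d p q"
    using lipschitz_extension[where i = i, OF M C] by (elim exE conjE) (rule that)
  have "(lip_const f)-lipschitz_on UNIV (\<lambda>y. h (k y))"
  proof (rule lipschitz_onI)
    fix y y'
    show "dist (h (k y)) (h (k y')) \<le> lip_const f * dist y y'"
      using h(2)[rule_format, of "k y" "k y'"] by (simp add: k dist_real_def)
  qed (rule C(1))
  then have "apply_lipfun (Abs_lipfun (\<lambda>y. h (k y))) = (\<lambda>y. h (k y))"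
    by (intro Abs_lipfun_inverse) blast
  with h show ?thesis
    by (intro exI[of _ h] exI[of _ "Abs_lipfun (\<lambda>y. h (k y))"]) simp
qed

lemma order_unit_Pair:
  assumes "order_unit eA" "0 \<le> eA" "order_unit eB" "0 \<le> eB"
  shows "order_unit (eA, eB)"
  unfolding order_unit_def
proof (intro conjI allI impI)
  fix ab :: "'a \<times> 'b"
  obtain r s where rs: "fst ab \<le> r *\<^sub>R eA" "snd ab \<le> s *\<^sub>R eB"
    using assms(1,3) unfolding order_unit_def by blast
  moreover have "r *\<^sub>R eA \<le> max r s *\<^sub>R eA" "s *\<^sub>R eB \<le> max r s *\<^sub>R eB"
    using assms(2,4) by (auto intro: scaleR_right_mono)
  ultimately show "\<exists>r. ab \<le> r *\<^sub>R (eA, eB)"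
    by (intro exI[of _ "max r s"]) (auto simp: less_eq_prod_def)
next
  fix ab :: "'a \<times> 'b" assume "\<forall>r>0. ab \<le> r *\<^sub>R (eA, eB)"
  then show "ab \<le> 0"
    using assms(1,3) by (auto simp: less_eq_prod_def order_unit_def)
qed

section \<open>Gluing functions and metrics on the disjoint union\<close>

definition join :: "'x::metric_space lipfun \<times> 'y::metric_space lipfun \<Rightarrow> 'x + 'y \<Rightarrow> real" where
  "join a = case_sum (apply_lipfun (fst a)) (apply_lipfun (snd a))"

lemma join_simps [simp]:
  "join a (Inl x) = apply_lipfun (fst a) x" "join a (Inr y) = apply_lipfun (snd a) y"
  by (simp_all add: join_def)

lemma join_add: "join (a + b) p = join a p + join b p"
  by (cases p) auto

lemma join_scaleR: "join (c *\<^sub>R a) p = c * join a p"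
  by (cases p) auto

locale glued_metric = Metric_space "UNIV :: ('x::metric_space + 'y::metric_space) set" d for d +
  assumes compact_left: "compact (UNIV :: 'x set)"
    and compact_right: "compact (UNIV :: 'y set)"
    and d_Inl [simp]: "d (Inl x) (Inl x') = dist x x'"
    and d_Inr [simp]: "d (Inr y) (Inr y') = dist y y'"
begin

definition L :: "'x lipfun \<times> 'y lipfun \<Rightarrow> real" where
  "L a = lip_seminorm d (join a)"

lemma tri: "d p r \<le> d p q + d q r"
  using triangle by simp

text \<open>The cross distance is continuous on the compact product, so it attains its minimum,
  which is positive as the two summands are disjoint.\<close>

lemma separated: obtains m where "0 < m" "\<And>x y. m \<le> d (Inl x) (Inr y)"
proof -
  have lip: "1-lipschitz_on UNIV (\<lambda>x. d (Inl x) (Inr y))" for y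
  proof (rule lipschitz_onI)
    fix x x' :: 'x
    show "dist (d (Inl x) (Inr y)) (d (Inl x') (Inr y)) \<le> 1 * dist x x'"
      using tri[of "Inl x" "Inr y" "Inl x'"] tri[of "Inl x'" "Inr y" "Inl x"]
      by (simp add: dist_real_def abs_le_iff dist_commute)
  qed simp
  have cont: "continuous_on UNIV (\<lambda>z. d (Inl (fst z)) (Inr (snd z)))"
  proof (rule lipschitz_on_continuous_on, rule lipschitz_onI)
    fix z z' :: "'x \<times> 'y"
    \<comment> \<open>One coordinate is moved at a time; each moves by at most
      \<open>dist z z'\<close>, hence the constant 2.\<close>
    have "d (Inl (fst z)) (Inr (snd z)) - d (Inl (fst z')) (Inr (snd z'))
        \<le> dist (fst z) (fst z') + dist (snd z) (snd z')" for z z'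
      using tri[of "Inl (fst z)" "Inr (snd z)" "Inl (fst z')"]
        tri[of "Inl (fst z')" "Inr (snd z)" "Inr (snd z')"] by (simp add: dist_commute)
    from this[of z z'] this[of z' z] show "dist (d (Inl (fst z)) (Inr (snd z)))
        (d (Inl (fst z')) (Inr (snd z'))) \<le> 2 * dist z z'"
      using dist_fst_le[of z z'] dist_snd_le[of z z']
      by (simp add: dist_real_def abs_le_iff dist_commute)
  qed simp
  have "compact (UNIV :: ('x \<times> 'y) set)"
    using compact_Times[OF compact_left compact_right] by simp
  then have "\<exists>z. \<forall>z'. d (Inl (fst z)) (Inr (snd z)) \<le> d (Inl (fst z')) (Inr (snd z'))"
    using continuous_attains_inf[OF _ _ cont] by blast
  then obtain z where z: "\<And>z'. d (Inl (fst z)) (Inr (snd z)) \<le> d (Inl (fst z')) (Inr (snd z'))"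
    by blast
  show thesis
  proof (rule that)
    show "0 < d (Inl (fst z)) (Inr (snd z))" by (simp add: mdist_pos_less)
    show "d (Inl (fst z)) (Inr (snd z)) \<le> d (Inl x) (Inr y)" for x y
      using z[of "(x, y)"] by simp
  qed
qed

text \<open>Within a summand the given Lipschitz constants suffice. Across the summands values
  differ by at most \<open>B1 + B2\<close> while points are at least \<open>m\<close> apart, which
  explains the quotient in \<open>K\<close>.\<close>

lemma join_lipschitz: obtains K where "\<And>p q. \<bar>join a p - join a q\<bar> \<le> K * d p q"
proof -
  obtain f g where a: "a = (f, g)" by (cases a)
  obtain m where m: "0 < m" "\<And>x y. m \<le> d (Inl x) (Inr y)"
    using separated by blast
  obtain B1 where B1: "\<And>x. \<bar>apply_lipfun f x\<bar> \<le> B1"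
    using lipfun_bounded[OF compact_left] by blast
  obtain B2 where B2: "\<And>x. \<bar>apply_lipfun g x\<bar> \<le> B2"
    using lipfun_bounded[OF compact_right] by blast
  obtain K1 where K1: "\<And>x y. \<bar>apply_lipfun f x - apply_lipfun f y\<bar> \<le> K1 * dist x y"
    using lipfun_lipschitz by blast
  obtain K2 where K2: "\<And>x y. \<bar>apply_lipfun g x - apply_lipfun g y\<bar> \<le> K2 * dist x y"
    using lipfun_lipschitz by blast
  define K where "K = max K1 (max K2 ((B1 + B2) / m))"
  have K: "K1 * d p q \<le> K * d p q" "K2 * d p q \<le> K * d p q" for p q
    by (auto simp: K_def intro!: mult_right_mono)
  have "0 \<le> B1 + B2" using B1 B2 by (meson abs_ge_zero add_nonneg_nonneg order_trans)
  then have "B1 + B2 \<le> K * d (Inl x) (Inr y)" for x y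
  proof -
    have "B1 + B2 = (B1 + B2) / m * m" using m by simp
    also have "\<dots> \<le> K * d (Inl x) (Inr y)"
      using m \<open>0 \<le> B1 + B2\<close> by (intro mult_mono) (auto simp: K_def le_max_iff_disj)
    finally show ?thesis .
  qed
  then have cross: "\<bar>apply_lipfun f x - apply_lipfun g y\<bar> \<le> K * d (Inl x) (Inr y)" for x y
    using B1[of x] B2[of y] by (smt (verit))
  have "\<bar>join a p - join a q\<bar> \<le> K * d p q" for p q
  proof (cases p; cases q)
    fix x x' assume "p = Inl x" "q = Inl x'"
    then show ?thesis using K1[of x x'] K(1)[of p q] by (simp add: a)
  next
    fix y y' assume "p = Inr y" "q = Inr y'"
    then show ?thesis using K2[of y y'] K(2)[of p q] by (simp add: a)
  next
    fix x y assume "p = Inl x" "q = Inr y"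
    then show ?thesis using cross[of x y] by (simp add: a)
  next
    fix y x assume "p = Inr y" "q = Inl x"
    then show ?thesis using cross[of x y] by (simp add: a commute abs_minus_commute)
  qed
  then show thesis by (rule that)
qed

lemma L_le_iff: "L a \<le> C \<longleftrightarrow> 0 \<le> C \<and> (\<forall>p q. \<bar>join a p - join a q\<bar> \<le> C * d p q)"
proof -
  obtain K where "\<And>p q. \<bar>join a p - join a q\<bar> \<le> K * d p q"
    using join_lipschitz by blast
  then show ?thesis unfolding L_def by (intro lip_seminorm_le_iff) auto
qed

lemma L_nonneg: "0 \<le> L a" and join_diff_le: "\<bar>join a p - join a q\<bar> \<le> L a * d p q"
  using L_le_iff[of a "L a"] by auto

lemma is_seminorm_L: "is_seminorm L"
proof -
  have scale: "L (c *\<^sub>R a) \<le> \<bar>c\<bar> * L a" for c a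
  proof -
    have "\<bar>join (c *\<^sub>R a) p - join (c *\<^sub>R a) q\<bar> \<le> \<bar>c\<bar> * L a * d p q" for p q
      using mult_left_mono[OF join_diff_le[of a p q], of "\<bar>c\<bar>"]
      by (simp add: join_scaleR mult.assoc flip: abs_mult right_diff_distrib)
    then show ?thesis by (simp add: L_le_iff L_nonneg)
  qed
  have "L (c *\<^sub>R a) = \<bar>c\<bar> * L a" for c a
  proof (cases "c = 0")
    case True
    then show ?thesis using scale[of 0 a] L_nonneg[of 0] by simp
  next
    case False
    \<comment> \<open>The reverse inequality is \<open>scale\<close> for the factor
      \<open>1/c\<close>.\<close>
    have "\<bar>c\<bar> * L a \<le> \<bar>c\<bar> * (\<bar>1/c\<bar> * L (c *\<^sub>R a))"
      using scale[of "1/c" "c *\<^sub>R a"] False by (intro mult_left_mono) auto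
    then show ?thesis using scale[of c a] False by (simp flip: mult.assoc abs_mult)
  qed
  moreover have "L (a + b) \<le> L a + L b" for a b
  proof -
    have "\<bar>join (a + b) p - join (a + b) q\<bar> \<le> (L a + L b) * d p q" for p q
      using join_diff_le[of a p q] join_diff_le[of b p q] unfolding join_add distrib_right by linarith
    then show ?thesis by (simp add: L_le_iff L_nonneg)
  qed
  ultimately show ?thesis by (simp add: is_seminorm_def L_nonneg)
qed

text \<open>The cross distances tie the two components together, so the kernel consists of one
  common constant and not of pairs of constants.\<close>

lemma L_eq_0_iff: "L a = 0 \<longleftrightarrow> a \<in> range (\<lambda>r. r *\<^sub>R (1, 1))"
proof
  assume "L a = 0"
  then have const: "join a p = join a q" for p q
    using join_diff_le[of a p q] by simp
  define r where "r = join a (Inl undefined)"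
  have "apply_lipfun (fst a) x = r" "apply_lipfun (snd a) y = r" for x y
    unfolding r_def using const by (metis join_simps)+
  then have "fst a = r *\<^sub>R 1" "snd a = r *\<^sub>R 1"
    by (simp_all add: fun_eq_iff flip: apply_lipfun_inject)
  then show "a \<in> range (\<lambda>r. r *\<^sub>R (1, 1))"
    by (intro range_eqI[of _ _ r]) (simp add: prod_eq_iff)
next
  assume "a \<in> range (\<lambda>r. r *\<^sub>R (1, 1))"
  then obtain r where "a = r *\<^sub>R (1, 1)" by blast
  then have "join a p = r" for p by (cases p) auto
  then show "L a = 0" using L_le_iff[of a 0] L_nonneg[of a] by simp
qed

text \<open>The finite family for \<open>lip_normI\<close> consists of the bumps of two partitions
  of unity, each extended by 0 to the other summand.\<close>

lemma lip_norm_L: "lip_norm (1, 1) L"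
proof (rule lip_normI)
  show "order_unit (1 :: 'x lipfun, 1 :: 'y lipfun)"
    by (intro order_unit_Pair order_unit_lipfun compact_left compact_right one_lipfun_nonneg)
  show "0 \<le> (1 :: 'x lipfun, 1 :: 'y lipfun)"
    by (simp add: less_eq_prod_def)
  show "L a = 0 \<longleftrightarrow> a \<in> range (\<lambda>r. r *\<^sub>R (1, 1))" for a by (rule L_eq_0_iff)
  fix \<epsilon> :: real assume "0 < \<epsilon>"
  obtain P and \<phi> :: "'x \<Rightarrow> 'x lipfun" where \<phi>: "lip_partition P \<phi> \<epsilon>"
    using lip_partition_exists[OF compact_left \<open>0 < \<epsilon>\<close>] .
  obtain Q and \<psi> :: "'y \<Rightarrow> 'y lipfun" where \<psi>: "lip_partition Q \<psi> \<epsilon>"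
    using lip_partition_exists[OF compact_right \<open>0 < \<epsilon>\<close>] .
  have fin: "finite P" "finite Q" using \<phi> \<psi> by (auto simp: lip_partition_def)
  define I where "I = P <+> Q"
  define b :: "'x + 'y \<Rightarrow> 'x lipfun \<times> 'y lipfun" where
    "b = case_sum (\<lambda>p. (\<phi> p, 0)) (\<lambda>q. (0, \<psi> q))"
  define o' :: "'x + 'y" where "o' = Inl undefined"
  have "finite I" using fin by (simp add: I_def)
  have approx: "\<exists>r c. (\<forall>i\<in>I. \<bar>c i\<bar> \<le> (\<Sum>i\<in>I. d i o')) \<and>
      - (\<epsilon> *\<^sub>R (1, 1)) \<le> a - r *\<^sub>R (1, 1) - (\<Sum>i\<in>I. c i *\<^sub>R b i) \<and>
      a - r *\<^sub>R (1, 1) - (\<Sum>i\<in>I. c i *\<^sub>R b i) \<le> \<epsilon> *\<^sub>R (1, 1)" if "L a \<le> 1" for a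
  proof -
    \<comment> \<open>Subtracting the value at the base point \<open>o'\<close> bounds the
      coefficient at \<open>i\<close> by \<open>d i o'\<close>, hence by the sum of these distances,
      whatever \<open>a\<close> is.\<close>
    define r where "r = join a o'"
    define c where "c i = join a i - r" for i
    have le: "\<bar>join a p - join a q\<bar> \<le> d p q" for p q
      using that by (simp add: L_le_iff)
    have "\<bar>c i\<bar> \<le> (\<Sum>i\<in>I. d i o')" if "i \<in> I" for i
      using le[of i o'] member_le_sum[OF that, of "\<lambda>i. d i o'"] \<open>finite I\<close> by (simp add: c_def r_def)
    moreover have "fst (\<Sum>i\<in>I. c i *\<^sub>R b i) = (\<Sum>p\<in>P. c (Inl p) *\<^sub>R \<phi> p)"
      "snd (\<Sum>i\<in>I. c i *\<^sub>R b i) = (\<Sum>q\<in>Q. c (Inr q) *\<^sub>R \<psi> q)"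
      using fin by (simp_all add: I_def b_def sum.Plus fst_sum snd_sum)
    moreover have "\<bar>apply_lipfun (fst a - r *\<^sub>R 1) x - c (Inl p)\<bar> \<le> \<epsilon>" if "dist x p < \<epsilon>" for x p
      using that le[of "Inl x" "Inl p"] by (simp add: c_def)
    note lip_partition_approx[OF \<phi> this]
    moreover have "\<bar>apply_lipfun (snd a - r *\<^sub>R 1) y - c (Inr q)\<bar> \<le> \<epsilon>" if "dist y q < \<epsilon>" for y q
      using that le[of "Inr y" "Inr q"] by (simp add: c_def)
    note lip_partition_approx[OF \<psi> this]
    ultimately show ?thesis
      by (intro exI[of _ r] exI[of _ c]) (simp add: less_eq_prod_def)
  qed
  show "\<exists>(I :: ('x + 'y) set) b C. finite I \<and> (\<forall>a. L a \<le> 1 \<longrightarrow> (\<exists>r c.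
      (\<forall>i\<in>I. \<bar>c i\<bar> \<le> C) \<and>
      - (\<epsilon> *\<^sub>R (1, 1)) \<le> a - r *\<^sub>R (1, 1) - (\<Sum>i\<in>I. c i *\<^sub>R b i) \<and>
      a - r *\<^sub>R (1, 1) - (\<Sum>i\<in>I. c i *\<^sub>R b i) \<le> \<epsilon> *\<^sub>R (1, 1)))"
  proof (rule exI[of _ I], rule exI[of _ b], rule exI[of _ "\<Sum>i\<in>I. d i o'"], intro conjI allI impI)
    show "finite I" by fact
  qed (rule approx)
qed (rule is_seminorm_L)

text \<open>Restricting a glued function to one summand cannot raise its constant, and the McShane
  extension of \<open>f\<close> supplies a \<open>g\<close> that attains the infimum.\<close>

lemma lip_const_eq_INF_left: "lip_const f = (INF g. L (f, g))"
proof (rule antisym)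
  show "lip_const f \<le> (INF g. L (f, g))"
  proof (rule cINF_greatest)
    fix g
    show "lip_const f \<le> L (f, g)"
      unfolding lip_const_le_iff
      using L_nonneg join_diff_le[of "(f, g)" "Inl x" "Inl y" for x y] by simp
  qed simp
  obtain g h where h: "\<forall>x. h (Inl x) = apply_lipfun f x" "\<forall>y. h (Inr y) = apply_lipfun g y"
    "\<forall>p q. \<bar>h p - h q\<bar> \<le> lip_const f * d p q"
    using lipfun_extension[where f = f and i = Inl and k = Inr, OF refl d_Inl d_Inr]
    by (elim exE conjE) (rule that)
  have "join (f, g) p = h p" for p
    by (cases p) (simp_all add: h)
  then have "L (f, g) \<le> lip_const f"
    using h(3) lip_const_le_iff[of f "lip_const f"] by (simp add: L_le_iff)
  moreover have "bdd_below (range (\<lambda>g. L (f, g)))"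
    using L_nonneg by (intro bdd_belowI) auto
  ultimately show "(INF g. L (f, g)) \<le> lip_const f"
    by (meson UNIV_I cINF_lower order_trans)
qed

lemma lip_const_eq_INF_right: "lip_const g = (INF f. L (f, g))"
proof (rule antisym)
  show "lip_const g \<le> (INF f. L (f, g))"
  proof (rule cINF_greatest)
    fix f
    show "lip_const g \<le> L (f, g)"
      unfolding lip_const_le_iff
      using L_nonneg join_diff_le[of "(f, g)" "Inr x" "Inr y" for x y] by simp
  qed simp
  obtain f h where h: "\<forall>x. h (Inr x) = apply_lipfun g x" "\<forall>y. h (Inl y) = apply_lipfun f y"
    "\<forall>p q. \<bar>h p - h q\<bar> \<le> lip_const g * d p q"
    using lipfun_extension[where f = g and i = Inr and k = Inl, OF refl d_Inr d_Inl]
    by (elim exE conjE) (rule that)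
  have "join (f, g) p = h p" for p
    by (cases p) (simp_all add: h)
  then have "L (f, g) \<le> lip_const g"
    using h(3) lip_const_le_iff[of g "lip_const g"] by (simp add: L_le_iff)
  moreover have "bdd_below (range (\<lambda>f. L (f, g)))"
    using L_nonneg by (intro bdd_belowI) auto
  ultimately show "(INF f. L (f, g)) \<le> lip_const g"
    by (meson UNIV_I cINF_lower order_trans)
qed

lemma L_admissible: "L \<in> admissible_lip_norms 1 lip_const 1 lip_const"
  unfolding admissible_lip_norms_def
  using lip_norm_L lip_const_eq_INF_left lip_const_eq_INF_right by blast

section \<open>Hausdorff distance of the state spaces\<close>

lemma rho_L_le:
  assumes "\<And>f g. (\<forall>x y. \<bar>apply_lipfun f x - apply_lipfun g y\<bar> \<le> d (Inl x) (Inr y))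
      \<Longrightarrow> \<bar>\<mu> f - \<nu> g\<bar> \<le> r" and "0 \<le> r"
  shows "rho L (\<mu> \<circ> fst) (\<nu> \<circ> snd) \<le> ennreal r"
proof -
  have "\<bar>\<mu> f - \<nu> g\<bar> \<le> r" if "L (f, g) \<le> 1" for f g
  \<comment> \<open>Of \<open>L (f, g) \<le> 1\<close> only the cross inequalities are kept, in the
    form that \<open>state_transport\<close> uses.\<close>
  proof (rule assms(1), intro allI)
    fix x y
    show "\<bar>apply_lipfun f x - apply_lipfun g y\<bar> \<le> d (Inl x) (Inr y)"
      using order_trans[OF join_diff_le[of "(f, g)" "Inl x" "Inr y"] mult_right_mono[OF that nonneg]]
      by simp
  qed
  then show ?thesis using \<open>0 \<le> r\<close> by (simp add: rho_le_iff)
qed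

text \<open>Nearness of the summands gives every point a partner on the other side, and
  \<open>state_transport\<close>, applied in both directions, turns this into partners for
  states.\<close>

lemma hausdorff_dist_states_le:
  "hausdorff_dist (rho L) ((\<lambda>\<mu>. \<mu> \<circ> fst) ` ou_states 1) ((\<lambda>\<nu>. \<nu> \<circ> snd) ` ou_states 1)
     \<le> hausdorff_dist (\<lambda>p q. ennreal (d p q)) (range Inl) (range Inr)" (is "_ \<le> ?H")
proof (rule ennreal_le_epsilon)
  fix \<delta> :: real assume "?H < top" "0 < \<delta>"
  then obtain h where h: "0 \<le> h" "?H = ennreal h"
    by (cases ?H) auto
  \<comment> \<open>One half of \<delta> turns bounds on infima into actual near points; the other
    half pays for the partition in \<open>state_transport\<close>.\<close>
  have lt: "?H < ennreal (h + \<delta>/2)"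
    using h \<open>0 < \<delta>\<close> by (simp add: ennreal_less_iff)
  have "(INF y. ennreal (d (Inl x) (Inr y))) \<le> ?H" for x
    unfolding hausdorff_dist_def by (intro max.coboundedI1 SUP_upper2[of "Inl x"]) (simp_all add: image_image)
  then have "(INF y. ennreal (d (Inl x) (Inr y))) < ennreal (h + \<delta>/2)" for x
    using lt by (rule order_le_less_trans)
  then have near_left: "\<exists>y. d (Inl x) (Inr y) \<le> h + \<delta>/2" for x
    unfolding INF_less_iff by (meson UNIV_I ennreal_less_iff less_imp_le nonneg)
  have "(INF x. ennreal (d (Inl x) (Inr y))) \<le> ?H" for y
    unfolding hausdorff_dist_def by (intro max.coboundedI2 SUP_upper2[of "Inr y"]) (simp_all add: image_image)
  then have "(INF x. ennreal (d (Inl x) (Inr y))) < ennreal (h + \<delta>/2)" for y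
    using lt by (rule order_le_less_trans)
  then have near_right: "\<exists>x. d (Inl x) (Inr y) \<le> h + \<delta>/2" for y
    unfolding INF_less_iff by (meson UNIV_I ennreal_less_iff less_imp_le nonneg)
  have d: "d (Inl x) (Inr y) \<le> dist x x' + d (Inl x') (Inr y)"
    "d (Inl x) (Inr y) \<le> dist y y' + d (Inl x) (Inr y')" for x x' y y'
    using tri[of "Inl x" "Inr y" "Inl x'"] tri[of "Inl x" "Inr y" "Inr y'"] by (auto simp: dist_commute)
  have r: "0 \<le> h + \<delta>/2 + \<delta>/2" "ennreal (h + \<delta>/2 + \<delta>/2) = ?H + ennreal \<delta>"
    using h \<open>0 < \<delta>\<close> by (auto simp: ennreal_plus[symmetric] simp del: ennreal_plus)
  have "\<exists>\<nu>\<in>ou_states 1. rho L (\<mu> \<circ> fst) (\<nu> \<circ> snd) \<le> ?H + ennreal \<delta>" if \<mu>: "\<mu> \<in> ou_states 1" for \<mu>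
  proof -
    obtain \<nu> where "\<nu> \<in> ou_states 1"
      and le: "\<And>f g. (\<forall>x y. \<bar>apply_lipfun f x - apply_lipfun g y\<bar> \<le> d (Inl x) (Inr y))
        \<Longrightarrow> \<bar>\<mu> f - \<nu> g\<bar> \<le> h + \<delta>/2 + \<delta>/2"
      using state_transport[where c = "\<lambda>x y. d (Inl x) (Inr y)", OF compact_left compact_right
          d(1) near_left \<mu> half_gt_zero[OF \<open>0 < \<delta>\<close>]] by blast
    have "rho L (\<mu> \<circ> fst) (\<nu> \<circ> snd) \<le> ennreal (h + \<delta>/2 + \<delta>/2)"
      by (rule rho_L_le[OF _ r(1)]) (rule le)
    then show ?thesis using \<open>\<nu> \<in> ou_states 1\<close> r(2) by auto
  qed
  moreover have "\<exists>\<mu>\<in>ou_states 1. rho L (\<mu> \<circ> fst) (\<nu> \<circ> snd) \<le> ?H + ennreal \<delta>" if \<nu>: "\<nu> \<in> ou_states 1" for \<nu>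
  proof -
    \<comment> \<open>Here the cost has its arguments swapped, so the transport runs from the second
      space to the first.\<close>
    obtain \<mu> where "\<mu> \<in> ou_states 1"
      and le: "\<And>g f. (\<forall>y x. \<bar>apply_lipfun g y - apply_lipfun f x\<bar> \<le> d (Inl x) (Inr y))
        \<Longrightarrow> \<bar>\<nu> g - \<mu> f\<bar> \<le> h + \<delta>/2 + \<delta>/2"
      using state_transport[where c = "\<lambda>y x. d (Inl x) (Inr y)", OF compact_right compact_left
          d(2) near_right \<nu> half_gt_zero[OF \<open>0 < \<delta>\<close>]] by blast
    have "rho L (\<mu> \<circ> fst) (\<nu> \<circ> snd) \<le> ennreal (h + \<delta>/2 + \<delta>/2)"
    proof (rule rho_L_le[OF _ r(1)])
      fix f g assume "\<forall>x y. \<bar>apply_lipfun f x - apply_lipfun g y\<bar> \<le> d (Inl x) (Inr y)"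
      then show "\<bar>\<mu> f - \<nu> g\<bar> \<le> h + \<delta>/2 + \<delta>/2"
        using le[of g f] by (simp add: abs_minus_commute)
    qed
    then show ?thesis using \<open>\<mu> \<in> ou_states 1\<close> r(2) by auto
  qed
  ultimately show "hausdorff_dist (rho L) ((\<lambda>\<mu>. \<mu> \<circ> fst) ` ou_states 1) ((\<lambda>\<nu>. \<nu> \<circ> snd) ` ou_states 1)
     \<le> ?H + ennreal \<delta>"
    unfolding hausdorff_dist_def image_image
    by (intro max.boundedI SUP_least) (auto intro: INF_lower2)
qed

lemma dist_q_le:
  "dist_q (1 :: 'x lipfun) lip_const (1 :: 'y lipfun) lip_const
     \<le> hausdorff_dist (\<lambda>p q. ennreal (d p q)) (range Inl) (range Inr)"
  unfolding dist_q_def by (rule INF_lower2) (rule L_admissible hausdorff_dist_states_le)+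

end

theorem proposition4p7:
  assumes "compact (UNIV :: 'x::metric_space set)"
    and "compact (UNIV :: 'y::metric_space set)"
  shows "dist_q (1 :: 'x lipfun) lip_const (1 :: 'y lipfun) lip_const
           \<le> dist_GH TYPE('x) TYPE('y)"
  unfolding dist_GH_def
proof (rule INF_greatest)
  fix d :: "'x + 'y \<Rightarrow> 'x + 'y \<Rightarrow> real" assume "d \<in> admissible_metrics"
  then have "glued_metric d"
    using assms by (simp add: admissible_metrics_def glued_metric_def glued_metric_axioms_def)
  then show "dist_q (1 :: 'x lipfun) lip_const (1 :: 'y lipfun) lip_const
      \<le> hausdorff_dist (\<lambda>p q. ennreal (d p q)) (range Inl) (range Inr)"
    by (rule glued_metric.dist_q_le)
qed

end
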